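(* Let $\mathbb{T}$ be a time scale and let $\kappa_0,\kappa_1:[0,1]\times\mathbb{T}\to[0,\infty)$ be rd-continuous functions such that, for all $t\in\mathbb{T}$, $$\lim_{\alpha\to0^+}\kappa_1(\alpha,t)=1,\quad \lim_{\alpha\to0^+}\kappa_0(\alpha,t)=0,\quad \lim_{\alpha\to1^-}\kappa_1(\alpha,t)=0,\quad \lim_{\alpha\to1^-}\kappa_0(\alpha,t)=1,$$ $\kappa_1(\alpha,t)\neq0$ for $\alpha\in[0,1)$, and $\kappa_0(\alpha,t)\neq0$ for $\alpha\in(0,1]$. For $\alpha\in[0,1]$ define, on the class of $\Delta$-differentiable functions $f:\mathbb{T}\to\mathbb{R}$, $$\Delta^{\alpha}f(t)=\kappa_1(\alpha,t)f(t)+\kappa_0(\alpha,t)f^{\Delta}(t),\qquad t\in\mathbb{T}^{\kappa}.$$ Then $\Delta^{\alpha}$ is conformable, i.e., for every $\Delta$-differentiable $f:\mathbb{T}\to\mathbb{R}$ one has $\Delta^{0}f=f$ and $\Delta^{1}f=f^{\Delta}$ on $\mathbb{T}^{\kappa}$.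
   Context: A time scale $\mathbb{T}$ is a nonempty closed subset of $\mathbb{R}$, with forward jump $\sigma(t)=\inf\{s\in\mathbb{T}:s>t\}$ and backward jump $\rho(t)=\sup\{s\in\mathbb{T}:s<t\}$ (with the usual conventions $\inf\emptyset=\sup\mathbb{T}$, $\sup\emptyset=\inf\mathbb{T}$). A point $t$ is right-dense if $t<\sup\mathbb{T}$ and $\sigma(t)=t$, left-dense if $t>\inf\mathbb{T}$ and $\rho(t)=t$, left-scattered if $\rho(t)<t$. $\mathbb{T}^{\kappa}=\mathbb{T}\setminus\{m\}$ if $\mathbb{T}$ has a left-scattered maximum $m$, and $\mathbb{T}^{\kappa}=\mathbb{T}$ otherwise. Delta derivative: for $t\in\mathbb{T}^\kappa$, $f^{\Delta}(t)$ is the number (if it exists) such that for every $\epsilon>0$ there is $\delta>0$ with $|[f(\sigma(t))-f(s)]-f^{\Delta}(t)[\sigma(t)-s]|\le\epsilon|\sigma(t)-s|$ for all $s\in(t-\delta,t+\delta)\cap\mathbb{T}$; $f$ is $\Delta$-differentiable if $f^\Delta(t)$ exists for all $t\in\mathbb{T}^{\kappa}$. A function $f:\mathbb{T}\to\mathbb{R}$ is rd-continuous if it is continuous at right-dense points and has finite left-sided limits at left-dense points. A function $k:[0,1]\times\mathbb{T}\to[0,\infty)$ is rd-continuous if $k(\alpha,\cdot)$ is rd-continuous for every $\alpha\in[0,1]$ and $k(\cdot,t)$ is continuous on $[0,1]$ for every $t\in\mathbb{T}$. *)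

theory Defs
  imports "HOL-Analysis.Analysis"
begin

text \<open>Functions on a time scale \<open>T\<close> are represented by total functions on the reals;
  at points of a time scale, none of the notions below depends on their values outside \<open>T\<close>.\<close>

definition time_scale :: "real set \<Rightarrow> bool" where
  "time_scale T \<longleftrightarrow> T \<noteq> {} \<and> closed T"

text \<open>In the two jump operators the case distinction implements the conventions
  \<open>inf {} = sup T\<close> and \<open>sup {} = inf T\<close>.  For \<open>t \<in> T\<close> the first case only occurs when \<open>t\<close>
  is the maximum (minimum) of \<open>T\<close>, so that \<open>Sup T\<close> (\<open>Inf T\<close>) is a genuine real supremum
  (infimum).\<close>

definition forward_jump :: "real set \<Rightarrow> real \<Rightarrow> real" where
  "forward_jump T t = (if {s \<in> T. t < s} = {} then Sup T else Inf {s \<in> T. t < s})"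

definition backward_jump :: "real set \<Rightarrow> real \<Rightarrow> real" where
  "backward_jump T t = (if {s \<in> T. s < t} = {} then Inf T else Sup {s \<in> T. s < t})"

text \<open>The bounds of \<open>T\<close> are taken in the extended reals because \<open>T\<close> may be unbounded.\<close>

definition right_dense :: "real set \<Rightarrow> real \<Rightarrow> bool" where
  "right_dense T t \<longleftrightarrow> ereal t < (SUP s\<in>T. ereal s) \<and> forward_jump T t = t"

definition left_dense :: "real set \<Rightarrow> real \<Rightarrow> bool" where
  "left_dense T t \<longleftrightarrow> (INF s\<in>T. ereal s) < ereal t \<and> backward_jump T t = t"

definition left_scattered :: "real set \<Rightarrow> real \<Rightarrow> bool" where
  "left_scattered T t \<longleftrightarrow> backward_jump T t < t"

definition time_scale_kappa :: "real set \<Rightarrow> real set" where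
  "time_scale_kappa T = T - {m \<in> T. (\<forall>s\<in>T. s \<le> m) \<and> left_scattered T m}"

definition has_delta_derivative :: "real set \<Rightarrow> (real \<Rightarrow> real) \<Rightarrow> real \<Rightarrow> real \<Rightarrow> bool" where
  "has_delta_derivative T f D t \<longleftrightarrow>
     (\<forall>\<epsilon>>0. \<exists>\<delta>>0. \<forall>s \<in> {t - \<delta><..<t + \<delta>} \<inter> T.
        \<bar>(f (forward_jump T t) - f s) - D * (forward_jump T t - s)\<bar>
          \<le> \<epsilon> * \<bar>forward_jump T t - s\<bar>)"

text \<open>On \<open>time_scale_kappa T\<close> the delta derivative is unique if it exists, except when \<open>T\<close> is a
  singleton: then every real number satisfies the defining condition, and \<open>SOME\<close>
  picks one of them.\<close>

definition delta_deriv :: "real set \<Rightarrow> (real \<Rightarrow> real) \<Rightarrow> real \<Rightarrow> real" where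
  "delta_deriv T f t = (SOME D. has_delta_derivative T f D t)"

definition delta_differentiable :: "real set \<Rightarrow> (real \<Rightarrow> real) \<Rightarrow> bool" where
  "delta_differentiable T f \<longleftrightarrow> (\<forall>t \<in> time_scale_kappa T. \<exists>D. has_delta_derivative T f D t)"

definition rd_continuous :: "real set \<Rightarrow> (real \<Rightarrow> real) \<Rightarrow> bool" where
  "rd_continuous T f \<longleftrightarrow>
     (\<forall>t\<in>T. right_dense T t \<longrightarrow> continuous (at t within T) f) \<and>
     (\<forall>t\<in>T. left_dense T t \<longrightarrow> (\<exists>l. (f \<longlongrightarrow> l) (at t within (T \<inter> {..<t}))))"

definition rd_continuous2 :: "real set \<Rightarrow> (real \<Rightarrow> real \<Rightarrow> real) \<Rightarrow> bool" where
  "rd_continuous2 T k \<longleftrightarrow>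
     (\<forall>\<alpha>\<in>{0..1}. rd_continuous T (k \<alpha>)) \<and>
     (\<forall>t\<in>T. continuous_on {0..1} (\<lambda>\<alpha>. k \<alpha> t))"

definition delta_alpha ::
  "real set \<Rightarrow> (real \<Rightarrow> real \<Rightarrow> real) \<Rightarrow> (real \<Rightarrow> real \<Rightarrow> real) \<Rightarrow> real \<Rightarrow> (real \<Rightarrow> real) \<Rightarrow> real \<Rightarrow> real"
  where "delta_alpha T \<kappa>0 \<kappa>1 \<alpha> f t = \<kappa>1 \<alpha> t * f t + \<kappa>0 \<alpha> t * delta_deriv T f t"

definition conformable :: "real set \<Rightarrow> (real \<Rightarrow> (real \<Rightarrow> real) \<Rightarrow> real \<Rightarrow> real) \<Rightarrow> bool" where
  "conformable T A \<longleftrightarrow>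
     (\<forall>f. delta_differentiable T f \<longrightarrow>
        (\<forall>t \<in> time_scale_kappa T. A 0 f t = f t) \<and>
        (\<forall>t \<in> time_scale_kappa T. A 1 f t = delta_deriv T f t))"

end

theory Submission
  imports Defs
begin

text \<open>The limits at the ends of the unit interval are one-sided and say nothing by themselves
  about the values at \<open>\<alpha> = 0\<close> and \<open>\<alpha> = 1\<close>.  Continuity of \<open>\<kappa>0\<close> and \<open>\<kappa>1\<close> in \<open>\<alpha>\<close> on the closed
  interval closes this gap: it forces the pair \<open>(\<kappa>1, \<kappa>0)\<close> to take the value \<open>(1, 0)\<close> at
  \<open>\<alpha> = 0\<close> and \<open>(0, 1)\<close> at \<open>\<alpha> = 1\<close>.  At these two parameters the combination of \<open>f\<close> and its
  delta derivative therefore collapses to one of its two terms.\<close>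

lemma rd_continuous2_at_0_eq_limit:
  assumes "rd_continuous2 T k" "t \<in> T" "((\<lambda>\<alpha>. k \<alpha> t) \<longlongrightarrow> L) (at_right 0)"
  shows "k 0 t = L"
proof -
  have "continuous_on {0..1} (\<lambda>\<alpha>. k \<alpha> t)"
    using assms(1,2) by (simp add: rd_continuous2_def)
  then have "((\<lambda>\<alpha>. k \<alpha> t) \<longlongrightarrow> k 0 t) (at_right 0)"
    by (rule continuous_on_Icc_at_rightD) simp
  then show ?thesis
    using assms(3) by (rule tendsto_unique[OF trivial_limit_at_right_real])
qed

lemma rd_continuous2_at_1_eq_limit:
  assumes "rd_continuous2 T k" "t \<in> T" "((\<lambda>\<alpha>. k \<alpha> t) \<longlongrightarrow> L) (at_left 1)"
  shows "k 1 t = L"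
proof -
  have "continuous_on {0..1} (\<lambda>\<alpha>. k \<alpha> t)"
    using assms(1,2) by (simp add: rd_continuous2_def)
  then have "((\<lambda>\<alpha>. k \<alpha> t) \<longlongrightarrow> k 1 t) (at_left 1)"
    by (rule continuous_on_Icc_at_leftD) simp
  then show ?thesis
    using assms(3) by (rule tendsto_unique[OF trivial_limit_at_left_real])
qed

theorem proposition3p2:
  fixes T :: "real set" and \<kappa>0 \<kappa>1 :: "real \<Rightarrow> real \<Rightarrow> real"
  assumes "time_scale T"
    and "\<And>\<alpha> t. \<alpha> \<in> {0..1} \<Longrightarrow> t \<in> T \<Longrightarrow> 0 \<le> \<kappa>0 \<alpha> t"
    and "\<And>\<alpha> t. \<alpha> \<in> {0..1} \<Longrightarrow> t \<in> T \<Longrightarrow> 0 \<le> \<kappa>1 \<alpha> t"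
    and "rd_continuous2 T \<kappa>0"
    and "rd_continuous2 T \<kappa>1"
    and "\<And>t. t \<in> T \<Longrightarrow> ((\<lambda>\<alpha>. \<kappa>1 \<alpha> t) \<longlongrightarrow> 1) (at_right 0)"
    and "\<And>t. t \<in> T \<Longrightarrow> ((\<lambda>\<alpha>. \<kappa>0 \<alpha> t) \<longlongrightarrow> 0) (at_right 0)"
    and "\<And>t. t \<in> T \<Longrightarrow> ((\<lambda>\<alpha>. \<kappa>1 \<alpha> t) \<longlongrightarrow> 0) (at_left 1)"
    and "\<And>t. t \<in> T \<Longrightarrow> ((\<lambda>\<alpha>. \<kappa>0 \<alpha> t) \<longlongrightarrow> 1) (at_left 1)"
    and "\<And>\<alpha> t. \<alpha> \<in> {0..<1} \<Longrightarrow> t \<in> T \<Longrightarrow> \<kappa>1 \<alpha> t \<noteq> 0"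
    and "\<And>\<alpha> t. \<alpha> \<in> {0<..1} \<Longrightarrow> t \<in> T \<Longrightarrow> \<kappa>0 \<alpha> t \<noteq> 0"
  shows "conformable T (delta_alpha T \<kappa>0 \<kappa>1)"
proof -
  have "\<kappa>1 0 t = 1" "\<kappa>0 0 t = 0" "\<kappa>1 1 t = 0" "\<kappa>0 1 t = 1" if "t \<in> T" for t
    using rd_continuous2_at_0_eq_limit[OF assms(5) that assms(6)[OF that]]
      rd_continuous2_at_0_eq_limit[OF assms(4) that assms(7)[OF that]]
      rd_continuous2_at_1_eq_limit[OF assms(5) that assms(8)[OF that]]
      rd_continuous2_at_1_eq_limit[OF assms(4) that assms(9)[OF that]]
    by simp_all
  moreover have "t \<in> T" if "t \<in> time_scale_kappa T" for t
    using that by (simp add: time_scale_kappa_def)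
  ultimately show ?thesis
    by (simp add: conformable_def delta_alpha_def)
qed

end
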